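(* The price of anarchy of financial network games under priority-proportional strategies is unbounded when negative external assets are allowed and firms aim to maximize their equity: for every $R>0$ there is a financial network with debt contracts only, real (possibly negative) external assets and no default costs, whose game has price of anarchy at least $R$.
   Context: Financial network: firms $v_1,\dots,v_n$; each $v_i$ has external assets $e_i\in\mathbb{R}$, possibly negative (a negative value represents an obligation to entities outside the network, which absorbs incoming payments first); $v_i$ owes $v_j$ the liability $l_{ij}\ge 0$, with $l_{ii}=0$ (both $l_{ij}>0$ and $l_{ji}>0$ are allowed); $L_i=\sum_j l_{ij}$. Priority-proportional strategy: a strategy $s_i$ of $v_i$ is a complete ordering, allowing ties, of its creditors, i.e. an ordered partition of $\{v_j: l_{ij}>0\}$ into priority classes $1,2,\dots$. Write $L_i^{(m)}$ for the total liability of $v_i$ to its $m$-th class, $k_{ij}$ for the index of the class of $v_i$ containing $v_j$, and $\pi'_{ij}=l_{ij}/L_i^{(k_{ij})}$. Clearing payments consistent with a strategy profile $\mathbf{s}=(s_1,\dots,s_n)$: a matrix $\mathbf{P}=(p_{ij})$ with $p_{ii}=0$, $0\le p_{ij}\le l_{ij}$ and, writing $p_i=\sum_j p_{ij}$, for every $i$: $p_i=L_i$ if $L_i\le e_i+\sum_j p_{ji}$, and $p_i=\max\{0,\,e_i+\sum_j p_{ji}\}$ otherwise; moreover for every creditor $v_j$ of $v_i$, $$p_{ij}=\min\Big\{\max\Big\{\Big(p_i-\sum_{m=1}^{k_{ij}-1}L_i^{(m)}\Big)\pi'_{ij},\,0\Big\},\,l_{ij}\Big\},$$ and $p_{ij}=0$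 if $l_{ij}=0$. Clearing payments are proper if every firm with a positive outgoing payment is reachable, by a (possibly trivial) directed path of edges $(v_i,v_j)$ with $p_{ij}>0$, from some firm with positive external assets. Only proper clearing payments are considered. For every profile $\mathbf{s}$ there are maximal ones, denoted $\mathbf{P}(\mathbf{s})$, which are entrywise at least as large as all other proper clearing payments consistent with $\mathbf{s}$. Equity: $E_i(\mathbf{P})=\max\{0,\ e_i+\sum_j p_{ji}-L_i\}$. The utility of $v_i$ under $\mathbf{s}$ is $E_i(\mathbf{P}(\mathbf{s}))$. A profile is a (pure) Nash equilibrium if no firm can strictly increase its utility by unilaterally changing its priority-proportional strategy. Social welfare: $SW(\mathbf{P})=\sum_i E_i(\mathbf{P})$; $OPT$ is the maximum of $SW(\mathbf{P}(\mathbf{s}))$ over all strategy profiles. The price of anarchy of an instance is the maximum of $OPT/SW(\mathbf{P}(\mathbf{s}))$ over Nash equilibria $\mathbf{s}$ (with $0/0=1$ and $x/0=+\infty$ for $x>0$). *)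

theory Defs
  imports Complex_Main "HOL-Library.FuncSet" "HOL-Library.Extended_Real"
begin

text \<open>The firms of a network \<open>N\<close> are \<open>1, \<dots>, num_firms N\<close>; the values of \<open>assets N\<close> and
  \<open>liability N\<close> at other indices are irrelevant.\<close>

record network =
  num_firms :: nat
  assets :: "nat \<Rightarrow> real"
  liability :: "nat \<Rightarrow> nat \<Rightarrow> real"

definition firms :: "network \<Rightarrow> nat set" where
  "firms N = {1..num_firms N}"

definition financial_network :: "network \<Rightarrow> bool" where
  "financial_network N \<longleftrightarrow>
     (\<forall>i\<in>firms N. \<forall>j\<in>firms N. 0 \<le> liability N i j) \<and> (\<forall>i\<in>firms N. liability N i i = 0)"

definition total_liability :: "network \<Rightarrow> nat \<Rightarrow> real" where
  "total_liability N i = (\<Sum>j\<in>firms N. liability N i j)"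

definition creditors :: "network \<Rightarrow> nat \<Rightarrow> nat set" where
  "creditors N i = {j \<in> firms N. 0 < liability N i j}"


text \<open>A priority-proportional strategy is an ordered partition of the creditors, given as the list
  of its classes in order of decreasing priority. Classes are numbered from \<open>1\<close>, list positions
  from \<open>0\<close>.\<close>

type_synonym strategy = "nat set list"
type_synonym profile = "nat \<Rightarrow> strategy"
type_synonym payments = "nat \<Rightarrow> nat \<Rightarrow> real"

definition strategies :: "network \<Rightarrow> nat \<Rightarrow> strategy set" where
  "strategies N i = {cs. {} \<notin> set cs \<and> \<Union>(set cs) = creditors N i \<and>
     (\<forall>a<length cs. \<forall>b<length cs. a \<noteq> b \<longrightarrow> cs ! a \<inter> cs ! b = {})}"

definition profiles :: "network \<Rightarrow> profile set" where
  "profiles N = Pi\<^sub>E (firms N) (strategies N)"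

definition class_index :: "profile \<Rightarrow> nat \<Rightarrow> nat \<Rightarrow> nat" where
  "class_index s i j = (THE m. 1 \<le> m \<and> m \<le> length (s i) \<and> j \<in> s i ! (m - 1))"

definition class_liability :: "network \<Rightarrow> profile \<Rightarrow> nat \<Rightarrow> nat \<Rightarrow> real" where
  "class_liability N s i m = (\<Sum>j\<in>s i ! (m - 1). liability N i j)"

definition rel_liability :: "network \<Rightarrow> profile \<Rightarrow> nat \<Rightarrow> nat \<Rightarrow> real" where
  "rel_liability N s i j = liability N i j / class_liability N s i (class_index s i j)"


definition outgoing :: "network \<Rightarrow> payments \<Rightarrow> nat \<Rightarrow> real" where
  "outgoing N P i = (\<Sum>j\<in>firms N. P i j)"

definition incoming :: "network \<Rightarrow> payments \<Rightarrow> nat \<Rightarrow> real" where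
  "incoming N P i = (\<Sum>j\<in>firms N. P j i)"

text \<open>Entries outside the \<open>n \<times> n\<close> matrix are fixed to \<open>0\<close>, so that distinct functions are distinct
  matrices.\<close>

definition clearing :: "network \<Rightarrow> profile \<Rightarrow> payments \<Rightarrow> bool" where
  "clearing N s P \<longleftrightarrow>
     (\<forall>i j. i \<notin> firms N \<or> j \<notin> firms N \<longrightarrow> P i j = 0) \<and>
     (\<forall>i\<in>firms N. P i i = 0) \<and>
     (\<forall>i\<in>firms N. \<forall>j\<in>firms N. 0 \<le> P i j \<and> P i j \<le> liability N i j) \<and>
     (\<forall>i\<in>firms N. outgoing N P i =
        (if total_liability N i \<le> assets N i + incoming N P i then total_liability N i
         else max 0 (assets N i + incoming N P i))) \<and>
     (\<forall>i\<in>firms N. \<forall>j\<in>creditors N i. P i j =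
        min (max ((outgoing N P i - (\<Sum>m\<in>{1..<class_index s i j}. class_liability N s i m))
                    * rel_liability N s i j) 0)
            (liability N i j)) \<and>
     (\<forall>i\<in>firms N. \<forall>j\<in>firms N. liability N i j = 0 \<longrightarrow> P i j = 0)"

definition payment_edges :: "network \<Rightarrow> payments \<Rightarrow> (nat \<times> nat) set" where
  "payment_edges N P = {(i, j). i \<in> firms N \<and> j \<in> firms N \<and> 0 < P i j}"

definition proper :: "network \<Rightarrow> payments \<Rightarrow> bool" where
  "proper N P \<longleftrightarrow> (\<forall>i\<in>firms N. 0 < outgoing N P i \<longrightarrow>
     (\<exists>k\<in>firms N. 0 < assets N k \<and> (k, i) \<in> (payment_edges N P)\<^sup>*))"

definition maximal_clearing :: "network \<Rightarrow> profile \<Rightarrow> payments \<Rightarrow> bool" where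
  "maximal_clearing N s P \<longleftrightarrow> clearing N s P \<and> proper N P \<and>
     (\<forall>Q. clearing N s Q \<and> proper N Q \<longrightarrow> (\<forall>i\<in>firms N. \<forall>j\<in>firms N. Q i j \<le> P i j))"

definition max_payments :: "network \<Rightarrow> profile \<Rightarrow> payments" where
  "max_payments N s = (THE P. maximal_clearing N s P)"


definition equity :: "network \<Rightarrow> payments \<Rightarrow> nat \<Rightarrow> real" where
  "equity N P i = max 0 (assets N i + incoming N P i - total_liability N i)"

definition utility :: "network \<Rightarrow> profile \<Rightarrow> nat \<Rightarrow> real" where
  "utility N s i = equity N (max_payments N s) i"

definition nash_equilibrium :: "network \<Rightarrow> profile \<Rightarrow> bool" where
  "nash_equilibrium N s \<longleftrightarrow> s \<in> profiles N \<and>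
     (\<forall>i\<in>firms N. \<forall>t\<in>strategies N i. utility N (s(i := t)) i \<le> utility N s i)"

definition social_welfare :: "network \<Rightarrow> payments \<Rightarrow> real" where
  "social_welfare N P = (\<Sum>i\<in>firms N. equity N P i)"

definition opt_welfare :: "network \<Rightarrow> real" where
  "opt_welfare N = Max ((\<lambda>s. social_welfare N (max_payments N s)) ` profiles N)"

definition welfare_ratio :: "real \<Rightarrow> real \<Rightarrow> ereal" where
  "welfare_ratio x y = (if y = 0 then if x = 0 then 1 else \<infinity> else ereal (x / y))"

text \<open>There are finitely many profiles, so the supremum is a maximum whenever an equilibrium exists;
  without equilibria it is \<open>-\<infinity>\<close>, so that a lower bound includes the existence of an equilibrium.\<close>

definition price_of_anarchy :: "network \<Rightarrow> ereal" where
  "price_of_anarchy N = (SUP s\<in>{s. nash_equilibrium N s}.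
     welfare_ratio (opt_welfare N) (social_welfare N (max_payments N s)))"


text \<open>The rest shows that the objects used above exist: the set of profiles is finite and nonempty,
  so \<^term>\<open>opt_welfare N\<close> is a genuine maximum, and maximal proper clearing payments exist uniquely
  for every profile, so \<^term>\<open>max_payments N s\<close> denotes them.\<close>

lemma finite_firms [simp]: "finite (firms N)"
  by (simp add: firms_def)

lemma finite_creditors [simp]: "finite (creditors N i)"
  by (simp add: creditors_def)

lemma finite_strategies: "finite (strategies N i)"
proof -
  have "distinct cs" if "cs \<in> strategies N i" for cs
  proof -
    have ne: "{} \<notin> set cs"
      and disj: "\<And>a b. a < length cs \<Longrightarrow> b < length cs \<Longrightarrow> a \<noteq> b \<Longrightarrow> cs ! a \<inter> cs ! b = {}"
      using that by (auto simp: strategies_def)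
    show ?thesis
      unfolding distinct_conv_nth
    proof (intro allI impI)
      fix a b assume ab: "a < length cs" "b < length cs" "a \<noteq> b"
      have "cs ! a \<noteq> {}" using ne ab(1) nth_mem by metis
      thus "cs ! a \<noteq> cs ! b" using disj[OF ab] by auto
    qed
  qed
  moreover have "set cs \<subseteq> Pow (creditors N i)" if "cs \<in> strategies N i" for cs
    using that by (auto simp: strategies_def)
  ultimately have "strategies N i \<subseteq> {cs. set cs \<subseteq> Pow (creditors N i) \<and> distinct cs}"
    by auto
  thus ?thesis
    by (rule finite_subset) (simp add: finite_subset_distinct)
qed

lemma strategies_nonempty: "strategies N i \<noteq> {}"
proof (cases "creditors N i = {}")
  case True
  hence "[] \<in> strategies N i" by (simp add: strategies_def)
  thus ?thesis by blast
next
  case False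
  hence "[creditors N i] \<in> strategies N i" by (simp add: strategies_def)
  thus ?thesis by blast
qed

lemma finite_profiles: "finite (profiles N)"
  unfolding profiles_def by (intro finite_PiE finite_firms finite_strategies)

lemma profiles_nonempty: "profiles N \<noteq> {}"
  by (simp add: profiles_def PiE_eq_empty_iff strategies_nonempty)

definition payable :: "network \<Rightarrow> payments \<Rightarrow> nat \<Rightarrow> real" where
  "payable N P i =
     (if total_liability N i \<le> assets N i + incoming N P i then total_liability N i
      else max 0 (assets N i + incoming N P i))"

definition share :: "network \<Rightarrow> profile \<Rightarrow> nat \<Rightarrow> real \<Rightarrow> nat \<Rightarrow> real" where
  "share N s i x j =
     (if i \<in> firms N \<and> j \<in> creditors N i then
        min (max ((x - (\<Sum>m\<in>{1..<class_index s i j}. class_liability N s i m))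
                    * rel_liability N s i j) 0) (liability N i j)
      else 0)"

definition clearing_step :: "network \<Rightarrow> profile \<Rightarrow> payments \<Rightarrow> payments" where
  "clearing_step N s P = (\<lambda>i j. share N s i (payable N P i) j)"

lemma class_index_eq:
  assumes "s i \<in> strategies N i" "m < length (s i)" "j \<in> s i ! m"
  shows "class_index s i j = Suc m"
  unfolding class_index_def
proof (rule the_equality)
  show "1 \<le> Suc m \<and> Suc m \<le> length (s i) \<and> j \<in> s i ! (Suc m - 1)"
    using assms by simp
next
  fix k assume k: "1 \<le> k \<and> k \<le> length (s i) \<and> j \<in> s i ! (k - 1)"
  hence "k - 1 < length (s i)" by auto
  with k assms have "k - 1 = m"
    unfolding strategies_def by blast
  with k show "k = Suc m" by arith
qed

lemma sum_prefix_min: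
  fixes C :: "nat \<Rightarrow> real"
  assumes "x \<ge> 0" "\<And>m. m < n \<Longrightarrow> C m \<ge> 0"
  shows "(\<Sum>m<n. min (max (x - (\<Sum>a<m. C a)) 0) (C m)) = min x (\<Sum>m<n. C m)"
  using assms(2)
proof (induction n)
  case 0
  thus ?case using assms(1) by simp
next
  case (Suc n)
  have "C n \<ge> 0" using Suc.prems by simp
  moreover have "(\<Sum>m<n. C m) \<ge> 0" using Suc.prems by (intro sum_nonneg) auto
  moreover have "(\<Sum>m<n. min (max (x - (\<Sum>a<m. C a)) 0) (C m)) = min x (\<Sum>m<n. C m)"
    using Suc by simp
  ultimately show ?case using assms(1) by (simp add: min_def max_def)
qed

context
  fixes N :: network and s :: profile
  assumes net: "financial_network N" and prof: "s \<in> profiles N"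
begin

lemma strat: "i \<in> firms N \<Longrightarrow> s i \<in> strategies N i"
  using prof by (auto simp: profiles_def)

lemma creditors_pos: "j \<in> creditors N i \<Longrightarrow> liability N i j > 0"
  by (simp add: creditors_def)

lemma clearing_outside:
  assumes "clearing N s P" "\<not> (i \<in> firms N \<and> j \<in> firms N)"
  shows "P i j = 0"
  using assms(2) conjunct1[OF assms(1)[unfolded clearing_def]] by blast

lemma class_subset:
  assumes "i \<in> firms N" "m < length (s i)"
  shows "s i ! m \<subseteq> creditors N i" "finite (s i ! m)"
proof -
  show "s i ! m \<subseteq> creditors N i"
    using strat[OF assms(1)] assms(2) nth_mem unfolding strategies_def by blast
  thus "finite (s i ! m)" by (rule finite_subset) simp
qed

lemma total_liability_nonneg: "i \<in> firms N \<Longrightarrow> total_liability N i \<ge> 0"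
  using net by (auto simp: total_liability_def financial_network_def intro!: sum_nonneg)

lemma creditors_eq: "i \<in> firms N \<Longrightarrow> creditors N i = (\<Union>m<length (s i). s i ! m)"
  using strat[of i] by (simp add: strategies_def set_conv_nth) blast

lemma sum_over_creditors:
  assumes "i \<in> firms N"
  shows "(\<Sum>j\<in>creditors N i. f j) = (\<Sum>m<length (s i). \<Sum>j\<in>s i ! m. f j)"
proof -
  have "(\<Sum>j\<in>(\<Union>m<length (s i). s i ! m). f j) = (\<Sum>m<length (s i). \<Sum>j\<in>s i ! m. f j)"
    using strat[OF assms] class_subset(2)[OF assms]
    by (intro sum.UNION_disjoint) (auto simp: strategies_def)
  thus ?thesis by (simp only: creditors_eq[OF assms])
qed

lemma total_liability_creditors:
  assumes "i \<in> firms N"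
  shows "total_liability N i = (\<Sum>j\<in>creditors N i. liability N i j)"
  unfolding total_liability_def
proof (rule sum.mono_neutral_right)
  show "\<forall>j\<in>firms N - creditors N i. liability N i j = 0"
    using net assms by (auto simp: creditors_def financial_network_def not_less intro: antisym)
qed (auto simp: creditors_def)

lemma sum_share:
  assumes i: "i \<in> firms N" and x: "0 \<le> x" "x \<le> total_liability N i"
  shows "(\<Sum>j\<in>firms N. share N s i x j) = x"
proof -
  define C where "C = (\<lambda>m. \<Sum>j\<in>s i ! m. liability N i j)"
  have pos: "liability N i j > 0" if "m < length (s i)" "j \<in> s i ! m" for m j
    using class_subset(1)[OF i that(1)] that(2) creditors_pos by blast
  have Cnn: "C m \<ge> 0" if "m < length (s i)" for m
    unfolding C_def using pos[OF that] by (intro sum_nonneg) (auto intro: less_imp_le)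
  have "(\<Sum>j\<in>firms N. share N s i x j) = (\<Sum>j\<in>creditors N i. share N s i x j)"
    by (rule sum.mono_neutral_right) (auto simp: creditors_def share_def)
  also have "\<dots> = (\<Sum>m<length (s i). \<Sum>j\<in>s i ! m. share N s i x j)"
    by (rule sum_over_creditors[OF i])
  also have "\<dots> = (\<Sum>m<length (s i). min (max (x - (\<Sum>a<m. C a)) 0) (C m))"
  proof (rule sum.cong[OF refl])
    fix m assume "m \<in> {..<length (s i)}"
    hence m: "m < length (s i)" by simp
    have "s i ! m \<noteq> {}" using strat[OF i] nth_mem[OF m] unfolding strategies_def by force
    hence Cpos: "C m > 0"
      unfolding C_def using pos[OF m] class_subset(2)[OF i m] by (intro sum_pos) auto
    define g where "g = min (max (x - (\<Sum>a<m. C a)) 0) (C m)"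
    have sh: "share N s i x j = liability N i j * (g / C m)" if j: "j \<in> s i ! m" for j
    proof -
      have lp: "liability N i j > 0" using pos[OF m j] .
      have ci: "class_index s i j = Suc m" using class_index_eq[of s i N m j] strat[OF i] m j by auto
      have "(\<Sum>k\<in>{1..<Suc m}. class_liability N s i k) = (\<Sum>a<m. C a)"
        unfolding class_liability_def C_def
        by (rule sum.reindex_bij_witness[of _ Suc "\<lambda>k. k - 1"]) auto
      hence "share N s i x j =
          min (max ((x - (\<Sum>a<m. C a)) * (liability N i j / C m)) 0) (liability N i j)"
        using class_subset(1)[OF i m] j i ci
        by (auto simp: share_def rel_liability_def class_liability_def C_def)
      also have "\<dots> = min (max ((x - (\<Sum>a<m. C a)) * (liability N i j / C m)) (0 * (liability N i j / C m)))
                         (C m * (liability N i j / C m))"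
        using Cpos by simp
      also have "\<dots> = g * (liability N i j / C m)"
        using Cpos lp by (simp only: g_def min_mult_distrib_right max_mult_distrib_right) simp
      finally show ?thesis by simp
    qed
    have "(\<Sum>j\<in>s i ! m. share N s i x j) = (\<Sum>j\<in>s i ! m. liability N i j) * (g / C m)"
      unfolding sum_distrib_right using sh by (rule sum.cong[OF refl])
    also have "\<dots> = g" using Cpos by (simp add: C_def)
    finally show "(\<Sum>j\<in>s i ! m. share N s i x j) = min (max (x - (\<Sum>a<m. C a)) 0) (C m)"
      by (simp add: g_def)
  qed
  also have "\<dots> = min x (\<Sum>m<length (s i). C m)"
    by (rule sum_prefix_min) (use x Cnn in auto)
  also have "(\<Sum>m<length (s i). C m) = total_liability N i"
    by (simp only: C_def total_liability_creditors[OF i] sum_over_creditors[OF i])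
  finally show ?thesis using x by simp
qed

lemma payable_bounds: "i \<in> firms N \<Longrightarrow> 0 \<le> payable N P i \<and> payable N P i \<le> total_liability N i"
  using total_liability_nonneg[of i] by (auto simp: payable_def)

lemma outgoing_step: "i \<in> firms N \<Longrightarrow> outgoing N (clearing_step N s P) i = payable N P i"
  using payable_bounds[of i P] by (simp add: outgoing_def clearing_step_def sum_share)

lemma clearing_iff: "clearing N s P \<longleftrightarrow> clearing_step N s P = P"
proof
  assume c: "clearing N s P"
  show "clearing_step N s P = P"
  proof (intro ext)
    fix i j
    have noncred: "liability N i j = 0" if "i \<in> firms N" "j \<in> firms N" "j \<notin> creditors N i"
      using that net by (auto simp: creditors_def financial_network_def not_less intro: antisym)
    show "clearing_step N s P i j = P i j"
    proof (cases "i \<in> firms N \<and> j \<in> creditors N i")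
      case True
      hence "outgoing N P i = payable N P i" using c by (simp add: clearing_def payable_def)
      with True c show ?thesis by (simp add: clearing_def clearing_step_def share_def)
    next
      case False
      have "P i j = 0"
      proof (cases "i \<in> firms N \<and> j \<in> firms N")
        case True
        with False noncred have "liability N i j = 0" by blast
        with True c show ?thesis unfolding clearing_def by blast
      next
        case False
        with c show ?thesis unfolding clearing_def by blast
      qed
      with False show ?thesis by (auto simp: clearing_step_def share_def)
    qed
  qed
next
  assume fp: "clearing_step N s P = P"
  hence P: "P i j = share N s i (payable N P i) j" for i j
    by (metis clearing_step_def)
  have out: "outgoing N P i = payable N P i" if "i \<in> firms N" for i
    using outgoing_step[OF that, of P] fp by simp
  have "liability N i i = 0" if "i \<in> firms N" for i
    using net that by (simp add: financial_network_def)
  moreover have "liability N i j \<ge> 0" if "i \<in> firms N" "j \<in> firms N" for i j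
    using net that by (simp add: financial_network_def)
  moreover have "P i j = min (max ((outgoing N P i - (\<Sum>m\<in>{1..<class_index s i j}. class_liability N s i m))
                    * rel_liability N s i j) 0) (liability N i j)"
    if "i \<in> firms N" "j \<in> creditors N i" for i j
    using that by (subst P) (simp add: share_def out)
  moreover have "P i j = 0" if "i \<notin> firms N \<or> j \<notin> creditors N i" for i j
    using that by (subst P) (auto simp: share_def)
  moreover have "0 \<le> P i j \<and> P i j \<le> liability N i j" if "i \<in> firms N" "j \<in> firms N" for i j
    using calculation(2)[OF that] by (subst (1 2) P) (auto simp: share_def min_def creditors_def)
  ultimately show "clearing N s P"
    using out unfolding clearing_def payable_def by (auto simp: creditors_def)
qed

lemma clearing_step_mono:
  assumes "P \<le> Q"
  shows "clearing_step N s P \<le> clearing_step N s Q"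
proof (intro le_funI)
  fix i j
  show "clearing_step N s P i j \<le> clearing_step N s Q i j"
  proof (cases "i \<in> firms N \<and> j \<in> creditors N i")
    case True
    hence i: "i \<in> firms N" and j: "j \<in> creditors N i" by auto
    have "incoming N P i \<le> incoming N Q i"
      unfolding incoming_def using assms by (intro sum_mono) (auto dest: le_funD)
    hence pay: "payable N P i \<le> payable N Q i"
      using total_liability_nonneg[OF i] by (auto simp: payable_def)
    have "class_liability N s i (class_index s i j) \<ge> 0"
    proof -
      obtain m where m: "m < length (s i)" "j \<in> s i ! m"
        using creditors_eq[OF i] j by blast
      have "class_index s i j = Suc m" using class_index_eq[of s i N m j] strat[OF i] m by auto
      thus ?thesis
        unfolding class_liability_def using class_subset(1)[OF i m(1)] creditors_pos
        by (simp, intro sum_nonneg) (blast intro: less_imp_le)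
    qed
    hence "rel_liability N s i j \<ge> 0"
      using creditors_pos[OF j] by (simp add: rel_liability_def)
    hence "(payable N P i - z) * rel_liability N s i j \<le> (payable N Q i - z) * rel_liability N s i j" for z
      using pay by (intro mult_right_mono) auto
    thus ?thesis using True
      by (simp only: clearing_step_def share_def simp_thms if_True) (intro min.mono max.mono order_refl)
  qed (auto simp: clearing_step_def share_def)
qed

lemma proper_step:
  assumes "proper N P" "P \<le> clearing_step N s P" "\<And>i j. 0 \<le> P i j"
  shows "proper N (clearing_step N s P)"
  unfolding proper_def
proof (intro ballI impI)
  let ?F = "clearing_step N s P"
  have sub: "payment_edges N P \<subseteq> payment_edges N ?F"
    using assms(2) by (auto simp: payment_edges_def le_fun_def intro: less_le_trans)
  fix i assume i: "i \<in> firms N" and "0 < outgoing N ?F i"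
  hence pay: "0 < payable N P i" by (simp add: outgoing_step)
  show "\<exists>k\<in>firms N. 0 < assets N k \<and> (k, i) \<in> (payment_edges N ?F)\<^sup>*"
  proof (cases "0 < assets N i")
    case True
    thus ?thesis using i by blast
  next
    case False
    have "0 < assets N i + incoming N P i"
      using pay by (auto simp: payable_def max_def split: if_splits)
    hence "0 < incoming N P i" using False by simp
    then obtain j where j: "j \<in> firms N" "0 < P j i"
      unfolding incoming_def by (meson not_less sum_nonpos)
    have "P j i \<le> outgoing N P j"
      unfolding outgoing_def using i assms(3) by (intro member_le_sum) auto
    then obtain k where k: "k \<in> firms N" "0 < assets N k" "(k, j) \<in> (payment_edges N P)\<^sup>*"
      using assms(1) j unfolding proper_def by (meson less_le_trans)
    have "(j, i) \<in> payment_edges N P" using i j by (simp add: payment_edges_def)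
    with k(3) have "(k, i) \<in> (payment_edges N P)\<^sup>*" by simp
    thus ?thesis using k rtrancl_mono[OF sub] by blast
  qed
qed

lemma maximal_clearing_exists: "\<exists>P. maximal_clearing N s P"
proof -
  define S where "S = {P. (\<forall>i j. 0 \<le> P i j) \<and> P \<le> clearing_step N s P \<and> proper N P}"
  have zero: "(\<lambda>_ _. 0) \<in> S"
    using net
    by (auto simp: S_def proper_def outgoing_def le_fun_def clearing_step_def share_def creditors_def)
  have share_le: "clearing_step N s P i j \<le> max 0 (liability N i j)" for P i j
    by (auto simp: clearing_step_def share_def)
  have bdd: "bdd_above ((\<lambda>P. P i j) ` S)" for i j
  proof (rule bdd_aboveI2)
    fix P assume "P \<in> S"
    hence "P i j \<le> clearing_step N s P i j" by (simp add: S_def le_fun_def)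
    thus "P i j \<le> max 0 (liability N i j)" using share_le by (rule order_trans)
  qed
  define M where "M = (\<lambda>i j. SUP P\<in>S. P i j)"
  have up: "P \<le> M" if "P \<in> S" for P
    unfolding M_def le_fun_def using that bdd by (auto intro: cSUP_upper)
  have M_pre: "M \<le> clearing_step N s M"
  proof (intro le_funI)
    fix i j
    show "M i j \<le> clearing_step N s M i j"
      unfolding M_def
    proof (rule cSUP_least)
      show "S \<noteq> {}" using zero by blast
    next
      fix P assume P: "P \<in> S"
      hence "P \<le> clearing_step N s P" by (simp add: S_def)
      also have "\<dots> \<le> clearing_step N s M" by (rule clearing_step_mono[OF up[OF P]])
      finally show "P i j \<le> clearing_step N s (\<lambda>i j. SUP P\<in>S. P i j) i j"
        by (simp add: le_fun_def M_def)
    qed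
  qed
  have M_nn: "0 \<le> M i j" for i j
    using up[OF zero] by (simp add: le_fun_def)
  have M_proper: "proper N M"
    unfolding proper_def
  proof (intro ballI impI)
    fix i assume i: "i \<in> firms N" and "0 < outgoing N M i"
    then obtain j where j: "j \<in> firms N" "0 < M i j"
      unfolding outgoing_def by (meson not_less sum_nonpos)
    then obtain P where P: "P \<in> S" "0 < P i j"
      using less_cSUP_iff[OF _ bdd] zero unfolding M_def by (metis empty_iff)
    have "P i j \<le> outgoing N P i"
      unfolding outgoing_def using j P(1) by (intro member_le_sum) (auto simp: S_def)
    then obtain k where k: "k \<in> firms N" "0 < assets N k" "(k, i) \<in> (payment_edges N P)\<^sup>*"
      using P i less_le_trans[OF P(2)] unfolding S_def proper_def by blast
    have "payment_edges N P \<subseteq> payment_edges N M"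
      using up[OF P(1)] by (auto simp: payment_edges_def le_fun_def intro: less_le_trans)
    thus "\<exists>k\<in>firms N. 0 < assets N k \<and> (k, i) \<in> (payment_edges N M)\<^sup>*"
      using k rtrancl_mono by blast
  qed
  have "clearing_step N s M \<in> S"
    using proper_step[OF M_proper M_pre M_nn] clearing_step_mono[OF M_pre] order_trans[OF M_nn le_funD[OF le_funD[OF M_pre]]]
    by (simp add: S_def)
  hence "clearing_step N s M = M" using up M_pre by (intro antisym)
  hence "clearing N s M" by (simp add: clearing_iff)
  moreover have "Q \<le> M" if "clearing N s Q" "proper N Q" for Q
  proof -
    have "0 \<le> Q i j" for i j
      using that(1) unfolding clearing_def by (metis order_refl)
    hence "Q \<in> S" using that by (simp add: S_def clearing_iff)
    thus ?thesis by (rule up)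
  qed
  ultimately have "maximal_clearing N s M"
    using M_proper unfolding maximal_clearing_def by (auto simp: le_fun_def)
  thus ?thesis by blast
qed

lemma maximal_clearing_unique:
  assumes "maximal_clearing N s P" "maximal_clearing N s Q"
  shows "P = Q"
proof (intro ext)
  fix i j
  show "P i j = Q i j"
  proof (cases "i \<in> firms N \<and> j \<in> firms N")
    case True
    thus ?thesis using assms unfolding maximal_clearing_def by (blast intro: antisym)
  next
    case False
    thus ?thesis using assms clearing_outside unfolding maximal_clearing_def by metis
  qed
qed

theorem maximal_clearing_max_payments: "maximal_clearing N s (max_payments N s)"
  unfolding max_payments_def
  using theI'[of "maximal_clearing N s"] maximal_clearing_exists maximal_clearing_unique by blast

end

end

theory Submission
  imports Defs
begin

text \<open>Firm 1 has asset 1 and owes 1 to each of the firms 2 and 3, so it is insolvent, has equity 0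
  whatever it does, and may favour either creditor at equilibrium. Money paid to firm 2, whose
  external assets are \<open>-1\<close>, is lost, whereas money paid to firm 3 becomes equity. Favouring
  firm 2 is therefore an equilibrium of welfare 0, while the optimal welfare is positive.\<close>

definition sink_network :: network where
  "sink_network = \<lparr>num_firms = 3,
     assets = (\<lambda>i. if i = 1 then 1 else if i = 2 then -1 else 0),
     liability = (\<lambda>i j. if i = 1 \<and> j \<in> {2, 3} then 1 else 0)\<rparr>"

text \<open>Restricted to the firms so that it lies in the extensional function space
  \<open>profiles\<close>. Firms 2 and 3 owe nothing, so \<open>[]\<close> is their only
  strategy.\<close>

definition favouring :: "nat \<Rightarrow> nat \<Rightarrow> profile" where
  "favouring a b = (\<lambda>i\<in>firms sink_network. if i = 1 then [{a}, {b}] else [])"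

lemma firms_sink [simp]: "firms sink_network = {1, 2, 3}"
  by (auto simp: firms_def sink_network_def)

lemma assets_sink [simp]:
  "assets sink_network i = (if i = 1 then 1 else if i = 2 then -1 else 0)"
  by (simp add: sink_network_def)

lemma liability_sink [simp]:
  "liability sink_network i j = (if i = 1 \<and> j \<in> {2, 3} then 1 else 0)"
  by (simp add: sink_network_def)

lemma total_liability_sink [simp]: "total_liability sink_network i = (if i = 1 then 2 else 0)"
  by (simp add: total_liability_def)

lemma creditors_sink [simp]: "creditors sink_network i = (if i = 1 then {2, 3} else {})"
  by (auto simp: creditors_def)

lemma financial_network_sink: "financial_network sink_network"
  by (simp add: financial_network_def)

lemma strategies_no_creditors:
  assumes "creditors N i = {}"
  shows "strategies N i = {[]}"
proof -
  have "cs = []" if "cs \<in> strategies N i" for cs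
    using that assms by (cases cs) (auto simp: strategies_def)
  thus ?thesis using assms by (auto simp: strategies_def)
qed

lemma favouring_profile:
  assumes "{a, b} = {2, 3}"
  shows "favouring a b \<in> profiles sink_network"
proof -
  have "a \<noteq> b" using assms by auto
  hence "[{a}, {b}] \<in> strategies sink_network 1"
    using assms by (auto simp: strategies_def less_Suc_eq)
  thus ?thesis
    by (auto simp: profiles_def favouring_def strategies_no_creditors)
qed

text \<open>Transfers facts about arbitrary clearing payments to \<open>max_payments\<close>, so the
  maximal payments need never be computed.\<close>

lemma clearing_sink:
  assumes "s \<in> profiles sink_network"
  shows "clearing sink_network s (max_payments sink_network s)"
  using maximal_clearing_max_payments[OF financial_network_sink assms]
  by (simp add: maximal_clearing_def)

lemma clearingD:
  assumes "clearing N s P"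
  shows "i \<notin> firms N \<or> j \<notin> firms N \<Longrightarrow> P i j = 0"
    and "i \<in> firms N \<Longrightarrow> j \<in> firms N \<Longrightarrow> 0 \<le> P i j"
    and "i \<in> firms N \<Longrightarrow> j \<in> firms N \<Longrightarrow> P i j \<le> liability N i j"
    and "i \<in> firms N \<Longrightarrow> outgoing N P i = payable N P i"
    and "i \<in> firms N \<Longrightarrow> j \<in> creditors N i \<Longrightarrow> P i j = share N s i (outgoing N P i) j"
  using assms unfolding clearing_def payable_def share_def by - (elim conjE; simp)+

text \<open>Firm 1 is the only debtor, so it receives nothing and its resources are its asset 1.
  This is less than its debt 2, so under every strategy it pays out exactly 1, split between firms 2
  and 3.\<close>

lemma
  assumes "clearing sink_network s P"
  shows clearing_sink_other: "i \<noteq> 1 \<or> j \<notin> {2, 3} \<Longrightarrow> P i j = 0"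
    and clearing_sink_outgoing: "outgoing sink_network P 1 = 1"
    and clearing_sink_split: "P 1 2 + P 1 3 = 1"
    and clearing_sink_bounds: "0 \<le> P 1 2" "P 1 2 \<le> 1" "0 \<le> P 1 3"
proof -
  note D = clearingD[OF assms]
  show other: "P i j = 0" if "i \<noteq> 1 \<or> j \<notin> {2, 3}" for i j
  proof (cases "i \<in> firms sink_network \<and> j \<in> firms sink_network")
    case True
    hence "0 \<le> P i j" "P i j \<le> liability sink_network i j" using D(2,3) by blast+
    moreover have "liability sink_network i j = 0" using that by auto
    ultimately show ?thesis by linarith
  qed (use D(1) in blast)
  have "incoming sink_network P 1 = 0"
    using other by (simp add: incoming_def)
  thus out: "outgoing sink_network P 1 = 1"
    using D(4)[of 1] by (simp add: payable_def)
  show "P 1 2 + P 1 3 = 1"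
    using out other[of 1 1] by (simp add: outgoing_def)
  show "0 \<le> P 1 2" "P 1 2 \<le> 1" "0 \<le> P 1 3"
    using D(2)[of 1 2] D(3)[of 1 2] D(2)[of 1 3] by simp_all
qed

text \<open>The single unit that firm 1 pays out exactly covers its first class, whose liability is
  1.\<close>

lemma clearing_favouring:
  assumes "{a, b} = {2, 3}" "clearing sink_network (favouring a b) P"
  shows "P 1 a = 1"
proof -
  let ?s = "favouring a b"
  have s1: "?s 1 = [{a}, {b}]" by (simp add: favouring_def)
  have "?s 1 \<in> strategies sink_network 1"
    using favouring_profile[OF assms(1)] by (auto simp: profiles_def)
  \<comment> \<open>List position 0 is class 1, so the sum over the classes preceding that of
    \<open>a\<close> is empty.\<close>
  hence ci: "class_index ?s 1 a = 1"
    using class_index_eq[of ?s 1 sink_network 0 a] s1 by simp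
  have a: "a \<in> {2, 3}" using assms(1) by blast
  have "rel_liability sink_network ?s 1 a = 1"
    using a s1 ci by (auto simp: rel_liability_def class_liability_def)
  moreover have "P 1 a = share sink_network ?s 1 1 a"
    using clearingD(5)[OF assms(2), of 1 a] clearing_sink_outgoing[OF assms(2)] a by simp
  ultimately show ?thesis using ci a by (auto simp: share_def)
qed

text \<open>Firm 1 has 1 against a debt of 2. Firm 2 receives at most 1, which its asset -1 absorbs.
  Firm 3 has neither assets nor debts and keeps all it receives.\<close>

lemma equity_sink:
  assumes "clearing sink_network s P"
  shows "equity sink_network P 1 = 0" "equity sink_network P 2 = 0"
    "equity sink_network P 3 = P 1 3"
  using clearing_sink_other[OF assms] clearing_sink_bounds[OF assms]
  by (simp_all add: equity_def incoming_def)

lemma social_welfare_sink: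
  assumes "clearing sink_network s P"
  shows "social_welfare sink_network P = P 1 3"
  using equity_sink[OF assms] by (simp add: social_welfare_def)

text \<open>No deviation can help: the equity of firm 1 is 0 under all clearing payments, and the
  other firms have a single strategy.\<close>

lemma nash_equilibrium_sink:
  assumes "s \<in> profiles sink_network"
  shows "nash_equilibrium sink_network s"
  unfolding nash_equilibrium_def
proof (intro conjI ballI assms)
  fix i t assume i: "i \<in> firms sink_network" and t: "t \<in> strategies sink_network i"
  show "utility sink_network (s(i := t)) i \<le> utility sink_network s i"
  proof (cases "i = 1")
    case True
    have "s(i := t) \<in> Pi\<^sub>E (insert i (firms sink_network)) (strategies sink_network)"
      by (intro PiE_fun_upd t assms[unfolded profiles_def])
    hence "s(i := t) \<in> profiles sink_network"
      by (simp only: profiles_def insert_absorb[OF i])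
    from clearing_sink[OF this] have "utility sink_network (s(i := t)) 1 = 0"
      unfolding utility_def by (rule equity_sink(1))
    moreover have "utility sink_network s 1 = 0"
      unfolding utility_def by (rule equity_sink(1)[OF clearing_sink[OF assms]])
    ultimately show ?thesis unfolding True by linarith
  next
    case False
    hence "strategies sink_network i = {[]}" by (simp add: strategies_no_creditors)
    moreover have "s i \<in> strategies sink_network i"
      using assms i unfolding profiles_def by (rule PiE_mem)
    ultimately have "t = s i" using t by (metis singletonD)
    thus ?thesis by (simp only: fun_upd_triv order_refl)
  qed
qed

theorem theorem16:
  fixes R :: real
  assumes "R > 0"
  shows "\<exists>N. financial_network N \<and> price_of_anarchy N \<ge> ereal R"
proof (intro exI conjI)
  let ?N = sink_network
  show "financial_network ?N" by (rule financial_network_sink)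
  have good: "favouring 3 2 \<in> profiles ?N" and bad: "favouring 2 3 \<in> profiles ?N"
    by (auto intro: favouring_profile)
  \<comment> \<open>With firm 3 ranked first, the whole unit becomes its equity.\<close>
  have "social_welfare ?N (max_payments ?N (favouring 3 2)) = 1"
    using clearing_favouring[OF _ clearing_sink[OF good]] social_welfare_sink[OF clearing_sink[OF good]]
    by auto
  hence opt: "opt_welfare ?N \<ge> 1"
    unfolding opt_welfare_def using good finite_profiles[of ?N]
    by (metis Max_ge finite_imageI imageI)
  \<comment> \<open>Firm 2 now takes the whole unit, and since the two payments sum to 1, firm 3
    gets nothing.\<close>
  have "social_welfare ?N (max_payments ?N (favouring 2 3)) = 0"
    using clearing_favouring[OF _ clearing_sink[OF bad]] clearing_sink_split[OF clearing_sink[OF bad]]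
      social_welfare_sink[OF clearing_sink[OF bad]]
    by simp
  \<comment> \<open>A positive optimum over welfare 0 counts as infinite, so this one network serves
    every \<open>R\<close>.\<close>
  hence "welfare_ratio (opt_welfare ?N) (social_welfare ?N (max_payments ?N (favouring 2 3))) = \<infinity>"
    using opt by (simp add: welfare_ratio_def)
  hence "\<infinity> \<le> price_of_anarchy ?N"
    unfolding price_of_anarchy_def using nash_equilibrium_sink[OF bad]
    by (metis (mono_tags, lifting) SUP_upper mem_Collect_eq)
  thus "price_of_anarchy ?N \<ge> ereal R" by simp
qed

end
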